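(* Let $x_0^0=\frac{t}{3^k}$ with $k,t\in\mathbb{N}$, $t$ and $3$ relatively prime, $k\neq 0$ and $0<t<3^k$. If $$m=\frac{2^\gamma}{(2\alpha+1)^\beta}$$ with $\alpha,\beta,\gamma$ integers, $\alpha,\beta,\gamma\geq 0$, then, for every $p,q,r,s\in\mathbb{Z}$ with $r,s\geq 0$, the point $\left(\frac{p}{2^r},\frac{q}{2^s}\right)$ does not lie on the line $y=m(x-x_0^0)$. *)

theory Defs
  imports Complex_Main
begin

end

theory Submission
  imports Defs
begin

text \<open>A dyadic point on the line would express \<open>x\<^sub>0\<close> through its coordinates as
  \<open>x\<^sub>0 = p / 2 ^ r - (q / 2 ^ s) / m\<close>. The reciprocal of \<open>m\<close> is an integer divided by a power of
  \<open>2\<close>, so \<open>x\<^sub>0\<close> itself would be a dyadic rational. But \<open>x\<^sub>0\<close> in lowest terms has a denominator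
  divisible by \<open>3\<close>.\<close>

text \<open>If \<open>t / 3 ^ k = a / 2 ^ n\<close>, then \<open>3 ^ k\<close> divides \<open>2 ^ n * t\<close>, to which it is coprime.\<close>

lemma coprime_over_power_3_not_dyadic:
  fixes t k n :: nat and a :: int
  assumes "coprime t 3" and "k \<noteq> 0"
  shows "real t / 3 ^ k \<noteq> real_of_int a / 2 ^ n"
proof
  assume "real t / 3 ^ k = real_of_int a / 2 ^ n"
  then have "real_of_int (int t * 2 ^ n) = real_of_int (a * 3 ^ k)"
    by (simp add: field_simps)
  then have "int t * 2 ^ n = a * 3 ^ k"
    by (simp only: of_int_eq_iff)
  then have "int (3 ^ k) dvd int (t * 2 ^ n)"
    by simp
  then have "3 ^ k dvd t * 2 ^ n"
    by (simp only: int_dvd_int_iff)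
  then have "3 dvd t * 2 ^ n"
    using \<open>k \<noteq> 0\<close> by (meson dvd_power dvd_trans gr0I)
  moreover have "coprime 3 (t * 2 ^ n)"
    using \<open>coprime t 3\<close> by (simp add: coprime_commute)
  ultimately have "is_unit (3 :: nat)"
    by (meson coprime_common_divisor dvd_refl)
  then show False
    by simp
qed

theorem theorem4p28:
  fixes k t \<alpha> \<beta> \<gamma> :: nat and x\<^sub>0 m :: real
  assumes "coprime t 3" and "k \<noteq> 0" and "0 < t" and "t < 3 ^ k"
    and "x\<^sub>0 = real t / 3 ^ k"
    and "m = 2 ^ \<gamma> / (2 * real \<alpha> + 1) ^ \<beta>"
  shows "\<forall>(p::int) (q::int) (r::nat) (s::nat).
    (real_of_int p / 2 ^ r, real_of_int q / 2 ^ s) \<notin> {(x, y). y = m * (x - x\<^sub>0)}"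
proof (intro allI notI)
  fix p q :: int and r s :: nat
  assume "(real_of_int p / 2 ^ r, real_of_int q / 2 ^ s) \<in> {(x, y). y = m * (x - x\<^sub>0)}"
  then have line: "real_of_int q / 2 ^ s = m * (real_of_int p / 2 ^ r - x\<^sub>0)"
    by simp
  define N :: int where "N = (2 * int \<alpha> + 1) ^ \<beta>"
  have "N \<noteq> 0"
    by (simp add: N_def)
  have m: "m = 2 ^ \<gamma> / real_of_int N"
    using assms(6) by (simp add: N_def)
  have "x\<^sub>0 = real_of_int p / 2 ^ r - real_of_int q / 2 ^ s / m"
    using line \<open>N \<noteq> 0\<close> by (simp add: m)
  also have "\<dots> = real_of_int (p * 2 ^ (\<gamma> + s) - q * N * 2 ^ r) / 2 ^ (r + \<gamma> + s)"
    using \<open>N \<noteq> 0\<close> by (simp add: m field_simps power_add)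
  finally show False
    using coprime_over_power_3_not_dyadic[OF assms(1,2)] assms(5) by metis
qed

end
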